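(* Let $A\in\mathbb R^{n\times n}$ and $B\in\mathbb R^{n\times m}$ be in the Jordan form $$A=\operatorname{diag}(A_r,J_1(0),J_2(0),\dots,J_{\alpha_0}(0)),\qquad B=\begin{bmatrix}B_r\\ B_0^1\\ \vdots\\ B_0^{\alpha_0}\end{bmatrix},$$ where $A_r\in\mathbb R^{r_0\times r_0}$ is the block diagonal matrix of all Jordan blocks of nonzero eigenvalues, $J_j(0)\in\mathbb R^{r_j\times r_j}$ ($j=1,\dots,\alpha_0$) are the Jordan blocks of the eigenvalue $0$ (zeros on the diagonal, ones on the superdiagonal), $\alpha_0$ is the geometric multiplicity of the eigenvalue $0$, $B_r\in\mathbb R^{r_0\times m}$ and $B_0^j\in\mathbb R^{r_j\times m}$. Consider the optimal control problem of minimizing $\bar J=\frac12\int_0^\infty(\bar x^\top\bar Q\bar x+\|v\|^2)\,dt$ subject to $\dot{\bar x}=\bar A\bar x+\bar Bv$. Suppose that $(\bar A,\bar B)$ is stabilizable (Assumption 1) and that the pair $(\bar C,\bar A)$ is undetectable, the only undetectable eigenvalue of $\bar A$ for $(\bar C,\bar A)$ is $0$, and its algebraic multiplicity and geometric multiplicity are equal (Assumption 2). Then for any linear exogenous system (i.e. for any matrices $F_1,F_2,G,H,K$), the steady state $x_{ss}$ of the multi-agent system must belong to $\operatorname{Im}(\widetilde X)$, where $$\widetilde X=\left[\begin{array}{c|c}A_r^{-1}B_rU_{B_{\text{last}}}&\\ \widetilde X_1&\\ \widetilde X_2& U_A\\ \vdots&\\ \widetilde X_{\alpha_0}&\end{array}\right],\qquad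 \widetilde X_i=\begin{bmatrix}0\\ B_0^i(1:r_i-1)\,U_{B_{\text{last}}}\end{bmatrix}\ (i=1,\dots,\alpha_0),$$ $$B_{\text{last}}=\begin{bmatrix}B_0^{1}(r_1)\\ B_0^{2}(r_2)\\ \vdots\\ B_0^{\alpha_0}(r_{\alpha_0})\end{bmatrix},$$ $U_{B_{\text{last}}}$ and $U_A$ are matrices whose columns form an orthonormal basis of $\operatorname{Ker}(B_{\text{last}})$ and $\operatorname{Ker}(A)$ respectively, and $\widetilde X$ is a matrix whose columns are linearly independent.
   Context: Notation: $B_0^i(1:r_i-1)\in\mathbb R^{(r_i-1)\times m}$ is formed by the first $r_i-1$ rows of $B_0^i$, and $B_0^i(r_i)\in\mathbb R^{1\times m}$ is its last row. In $\widetilde X$ the matrix $U_A$ (with $n$ rows) is placed to the right of the stacked left block. (In the paper $\operatorname{Im}(\widetilde X)$ is called the maximal steady-state space.) Setting. Consider the multi-agent system $\dot x=Ax+Bu$ with $x(t)\in\mathbb R^n$, $u(t)\in\mathbb R^m$. An exogenous system with state $w\in\mathbb R^k$ and new control $v\in\mathbb R^p$ is attached: $\dot w=F_1x+F_2w+Gv$, $u=Hw+Kv$, with $F_1\in\mathbb R^{k\times n}$, $F_2\in\mathbb R^{k\times k}$, $G\in\mathbb R^{k\times p}$, $H\in\mathbb R^{m\times k}$, $K\in\mathbb R^{m\times p}$. Let $Q=C^\top C$ with $C\in\mathbb R^{q\times n}$. Put $$\bar x=\begin{bmatrix}x\\ w\end{bmatrix},\quad \bar A=\begin{bmatrix}A&BH\\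 F_1&F_2\end{bmatrix},\quad \bar B=\begin{bmatrix}BK\\ G\end{bmatrix},\quad \bar C=[\,C\ \ 0_{q\times k}\,],\quad \bar Q=\bar C^\top\bar C.$$ $P$ denotes the smallest real symmetric positive semi-definite solution of $\bar A^\top P+P\bar A-P\bar B\bar B^\top P+\bar Q=0$ (smallest: $P_0-P$ is positive semi-definite for every other real symmetric positive semi-definite solution $P_0$); it exists when $(\bar A,\bar B)$ is stabilizable, and the optimal control is $v^*=-\bar B^\top P\bar x$. The closed-loop system is $\dot{\bar x}=\bar A_{cl}\bar x$ with $\bar A_{cl}=\bar A-\bar B\bar B^\top P$. The steady state is $\bar x_{ss}=\begin{bmatrix}x_{ss}\\ w_{ss}\end{bmatrix}=\lim_{t\to\infty}\bar x(t)$ for the closed-loop system from a given initial state $\bar x(0)$; $x_{ss}\in\mathbb R^n$ is the steady state of the multi-agent system. An undetectable eigenvalue of $\bar A$ for $(\bar C,\bar A)$ is a $\lambda\in\mathbb C$ with $\operatorname{Re}\lambda\ge 0$ for which there is $\phi\ne0$ with $\bar A\phi=\lambda\phi$, $\bar C\phi=0$. Equality of the algebraic and geometric multiplicities of the undetectable eigenvalue $0$ means: there are no $\phi\neq 0$ and $\hat\phi$ with $\bar A\phi=0$, $\bar C\phi=0$, $\bar A\hat\phi=\phi$, $\bar C\hat\phi=0$.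
   Formalization: The linear independence of the columns of X̃ is proved only when the columns of B are linearly independent; otherwise it fails (e.g. A=[0], B=[1 1] gives X̃=[0|1]). The membership of x_ss in Im(X̃) is proved without this condition. *)

theory Defs
  imports
    Complex_Main
    "Jordan_Normal_Form.Jordan_Normal_Form"
    "Jordan_Normal_Form.Gauss_Jordan_Elimination"
    "Jordan_Normal_Form.Matrix_Kernel"
    "Jordan_Normal_Form.VS_Connect"
begin

abbreviation cmat :: "real mat \<Rightarrow> complex mat" where
  "cmat \<equiv> map_mat complex_of_real"


definition append_cols_mat :: "'a :: zero mat \<Rightarrow> 'a mat \<Rightarrow> 'a mat" where
  "append_cols_mat M N = four_block_mat M N (0\<^sub>m 0 (dim_col M)) (0\<^sub>m 0 (dim_col N))"

text \<open>The number of columns \<open>c\<close> is a parameter because the list of blocks may be empty.\<close>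

definition stack_rows :: "nat \<Rightarrow> 'a :: zero mat list \<Rightarrow> 'a mat" where
  "stack_rows c Ms = foldr append_rows Ms (0\<^sub>m 0 c)"

definition init_rows :: "'a mat \<Rightarrow> 'a mat" where
  "init_rows M = mat (dim_row M - 1) (dim_col M) (\<lambda>(i, j). M $$ (i, j))"

definition last_row :: "'a mat \<Rightarrow> 'a vec" where
  "last_row M = row M (dim_row M - 1)"

text \<open>
  For a real matrix, the Jordan blocks of a non-real eigenvalue \<open>a + b * \<i>\<close> and of its conjugate
  are combined into one real block: the diagonal consists of 2-by-2 blocks with rows
  \<open>(a, b)\<close> and \<open>(-b, a)\<close>, the superdiagonal of 2-by-2 identity blocks.
  The parameter \<open>s\<close> is the size of the complex Jordan block, so such a block has size \<open>2 * s\<close>.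
  For a real eigenvalue this is the usual Jordan block of size \<open>s\<close>.
\<close>

definition real_jordan_block :: "nat \<Rightarrow> complex \<Rightarrow> real mat" where
  "real_jordan_block s z =
    (if Im z = 0 then jordan_block s (Re z)
     else mat (2 * s) (2 * s) (\<lambda>(i, j).
       if i div 2 = j div 2 then
         (if i = j then Re z else if i < j then Im z else - Im z)
       else if Suc (i div 2) = j div 2 \<and> i mod 2 = j mod 2 then 1 else 0))"


definition psd :: "nat \<Rightarrow> real mat \<Rightarrow> bool" where
  "psd d P \<longleftrightarrow> P \<in> carrier_mat d d \<and> transpose_mat P = P \<and>
     (\<forall>x \<in> carrier_vec d. 0 \<le> x \<bullet> (P *\<^sub>v x))"

definition orthonormal_basis_cols :: "real mat \<Rightarrow> real vec set \<Rightarrow> bool" where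
  "orthonormal_basis_cols U W \<longleftrightarrow>
     (\<forall>i < dim_col U. \<forall>j < dim_col U. col U i \<bullet> col U j = (if i = j then 1 else 0)) \<and>
     vec_space.col_space (dim_row U) U = W"

definition lin_indpt_cols :: "real mat \<Rightarrow> bool" where
  "lin_indpt_cols M \<longleftrightarrow> distinct (cols M) \<and>
     \<not> module.lin_dep class_ring (module_vec TYPE(real) (dim_row M)) (set (cols M))"


definition stabilizable :: "real mat \<Rightarrow> real mat \<Rightarrow> bool" where
  "stabilizable A B \<longleftrightarrow>
     (\<exists>L \<in> carrier_mat (dim_col B) (dim_row A).
        \<forall>z. eigenvalue (cmat (A + B * L)) z \<longrightarrow> Re z < 0)"

definition undetectable_eigenvalue :: "real mat \<Rightarrow> real mat \<Rightarrow> complex \<Rightarrow> bool" where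
  "undetectable_eigenvalue C A z \<longleftrightarrow> Re z \<ge> 0 \<and>
     (\<exists>\<phi>. eigenvector (cmat A) \<phi> z \<and> cmat C *\<^sub>v \<phi> = 0\<^sub>v (dim_row C))"

definition undetectable_zero_semisimple :: "real mat \<Rightarrow> real mat \<Rightarrow> bool" where
  "undetectable_zero_semisimple C A \<longleftrightarrow>
     \<not> (\<exists>\<phi> \<in> carrier_vec (dim_row A). \<exists>\<phi>' \<in> carrier_vec (dim_row A).
          \<phi> \<noteq> 0\<^sub>v (dim_row A) \<and>
          cmat A *\<^sub>v \<phi> = 0\<^sub>v (dim_row A) \<and> cmat C *\<^sub>v \<phi> = 0\<^sub>v (dim_row C) \<and>
          cmat A *\<^sub>v \<phi>' = \<phi> \<and> cmat C *\<^sub>v \<phi>' = 0\<^sub>v (dim_row C))"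

definition psd_are_solution :: "real mat \<Rightarrow> real mat \<Rightarrow> real mat \<Rightarrow> real mat \<Rightarrow> bool" where
  "psd_are_solution A B Q P \<longleftrightarrow> psd (dim_row A) P \<and>
     transpose_mat A * P + P * A - P * B * transpose_mat B * P + Q
       = 0\<^sub>m (dim_row A) (dim_row A)"

definition smallest_psd_are_solution :: "real mat \<Rightarrow> real mat \<Rightarrow> real mat \<Rightarrow> real mat \<Rightarrow> bool" where
  "smallest_psd_are_solution A B Q P \<longleftrightarrow> psd_are_solution A B Q P \<and>
     (\<forall>P'. psd_are_solution A B Q P' \<longrightarrow> psd (dim_row A) (P' - P))"

text \<open>Vectors carry no topology in this library: derivatives and limits are componentwise.\<close>

definition lti_trajectory :: "real mat \<Rightarrow> real vec \<Rightarrow> (real \<Rightarrow> real vec) \<Rightarrow> bool" where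
  "lti_trajectory M x0 x \<longleftrightarrow> x 0 = x0 \<and>
     (\<forall>t \<ge> 0. x t \<in> carrier_vec (dim_row M) \<and>
        (\<forall>i < dim_row M.
           ((\<lambda>s. x s $ i) has_real_derivative (M *\<^sub>v x t) $ i) (at t within {0..})))"

definition vec_tendsto_at_top :: "(real \<Rightarrow> real vec) \<Rightarrow> real vec \<Rightarrow> bool" where
  "vec_tendsto_at_top x l \<longleftrightarrow>
     (\<forall>i < dim_vec l. ((\<lambda>t. x t $ i) \<longlongrightarrow> l $ i) at_top)"

definition steady_state :: "real mat \<Rightarrow> real vec \<Rightarrow> real vec \<Rightarrow> bool" where
  "steady_state M x0 xss \<longleftrightarrow> xss \<in> carrier_vec (dim_row M) \<and>
     (\<exists>x. lti_trajectory M x0 x \<and> vec_tendsto_at_top x xss)"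


definition B_last :: "nat \<Rightarrow> real mat list \<Rightarrow> real mat" where
  "B_last m Bs = mat_of_rows m (map last_row Bs)"

definition X_tilde_block :: "real mat \<Rightarrow> real mat \<Rightarrow> real mat" where
  "X_tilde_block Bi U = 0\<^sub>m 1 (dim_col U) @\<^sub>r (init_rows Bi * U)"

text \<open>
  The inverse of \<open>Ar\<close> is only meaningful when \<open>Ar\<close> is invertible, which is the case for a block
  diagonal matrix of Jordan blocks with nonzero eigenvalues.
\<close>

definition X_tilde ::
  "real mat \<Rightarrow> real mat \<Rightarrow> real mat list \<Rightarrow> real mat \<Rightarrow> real mat \<Rightarrow> real mat" where
  "X_tilde Ar Br Bs U_B U_A =
     append_cols_mat
       (stack_rows (dim_col U_B)
          (the (mat_inverse Ar) * Br * U_B # map (\<lambda>Bi. X_tilde_block Bi U_B) Bs))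
       U_A"

end

theory Submission
  imports Defs "Jordan_Normal_Form.DL_Rank"
begin

text \<open>
  A limit of a trajectory of the closed loop is an equilibrium of it (\<open>steady_state_in_kernel\<close>). At an
  equilibrium the Riccati equation forces the optimal feedback to vanish
  (\<open>closed_loop_kernel_subset_open_loop_kernel\<close>), so the steady state is an equilibrium of the
  extended system without control. Its agent part \<open>x\<close> therefore satisfies \<open>A x + B u = 0\<close>,
  where \<open>u = H w\<close> is produced by the exogenous state \<open>w\<close>. Whatever the exogenous system is, it
  enters only through this constant input.

  The rest is linear algebra of the Jordan form. The last row of each nilpotent block
  of \<open>A\<close> is zero, so \<open>u\<close> lies in the kernel of \<open>B_last\<close> (\<open>B_last_mult_eq_0\<close>), that is,
  \<open>u = U_B y\<close>. The left half \<open>L\<close> of \<open>X_tilde\<close> is built such that \<open>A L = B U_B\<close>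
  (\<open>X_tilde_left_block\<close>). Hence \<open>A (x + L y) = 0\<close>, so \<open>x = L (- y) + U_A z\<close> for some \<open>z\<close>.

  The same identity gives the independence of the columns: if \<open>L y + U_A z = 0\<close>, applying
  \<open>A\<close> gives \<open>B U_B y = 0\<close>. When the columns of \<open>B\<close> are independent, this implies \<open>y = 0\<close>, and then
  \<open>z = 0\<close>, as \<open>U_B\<close> and \<open>U_A\<close> have orthonormal columns.
\<close>


section \<open>Equilibria of the optimal closed loop\<close>

text \<open>
  By the mean value theorem every increment over a unit time interval is a value of the derivative
  at some later time. As time tends to infinity the increments of a convergent trajectory vanish,
  whereas the derivative converges to the value of the right-hand side at the limit.
\<close>

lemma steady_state_in_kernel:
  assumes M: "M \<in> carrier_mat d d" and ss: "steady_state M x0 l"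
  shows "M *\<^sub>v l = 0\<^sub>v d"
proof -
  obtain x where x: "lti_trajectory M x0 x" and lim: "vec_tendsto_at_top x l"
    and l: "l \<in> carrier_vec d"
    using ss M unfolding steady_state_def by auto
  have xc: "x t \<in> carrier_vec d" if "t \<ge> 0" for t
    using x M that unfolding lti_trajectory_def by auto
  have der: "((\<lambda>s. x s $ i) has_real_derivative (M *\<^sub>v x t) $ i) (at t)"
    if "t > 0" "i < d" for t i
  proof -
    have "((\<lambda>s. x s $ i) has_real_derivative (M *\<^sub>v x t) $ i) (at t within {0..})"
      using x M that unfolding lti_trajectory_def by auto
    then have "((\<lambda>s. x s $ i) has_real_derivative (M *\<^sub>v x t) $ i) (at t within {0<..})"
      by (rule has_field_derivative_subset) auto
    then show ?thesis
      using that by (simp add: at_within_open[of t "{0<..}"])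
  qed
  have xi: "((\<lambda>t. x t $ i) \<longlongrightarrow> l $ i) at_top" if "i < d" for i
    using lim l that unfolding vec_tendsto_at_top_def by auto
  have "(M *\<^sub>v l) $ i = 0" if i: "i < d" for i
  proof -
    let ?f = "\<lambda>t. x t $ i" and ?g = "\<lambda>t. (M *\<^sub>v x t) $ i"
    have entry: "(M *\<^sub>v v) $ i = (\<Sum>j<d. M $$ (i, j) * v $ j)" if "v \<in> carrier_vec d" for v
      using that M i by (auto simp: scalar_prod_def atLeast0LessThan intro!: sum.cong)
    have "((\<lambda>t. \<Sum>j<d. M $$ (i, j) * x t $ j) \<longlongrightarrow> (\<Sum>j<d. M $$ (i, j) * l $ j)) at_top"
      by (intro tendsto_intros xi) auto
    moreover have "\<forall>\<^sub>F t in at_top. (\<Sum>j<d. M $$ (i, j) * x t $ j) = ?g t"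
      using eventually_ge_at_top[of "0::real"] by eventually_elim (simp add: entry xc)
    ultimately have g: "(?g \<longlongrightarrow> (M *\<^sub>v l) $ i) at_top"
      unfolding entry[OF l] by (rule Lim_transform_eventually)
    have "\<exists>z. t < z \<and> z < t + 1 \<and> ?f (t + 1) - ?f t = (t + 1 - t) * ?g z" if "t > 0" for t
      by (rule MVT2) (use that i in \<open>auto intro!: der\<close>)
    then obtain \<xi> where \<xi>: "\<And>t. t > 0 \<Longrightarrow> t < \<xi> t \<and> ?f (t + 1) - ?f t = ?g (\<xi> t)"
      by (auto simp: algebra_simps) metis
    \<comment> \<open>The intermediate times \<open>\<xi> t > t\<close> escape to infinity.\<close>
    have "filterlim \<xi> at_top at_top"
      by (rule filterlim_at_top_mono[OF filterlim_ident])
        (use eventually_gt_at_top[of "0::real"] in eventually_elim, use \<xi> in force)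
    then have "((\<lambda>t. ?g (\<xi> t)) \<longlongrightarrow> (M *\<^sub>v l) $ i) at_top"
      by (rule filterlim_compose[OF g])
    moreover have "\<forall>\<^sub>F t in at_top. ?g (\<xi> t) = ?f (t + 1) - ?f t"
      using eventually_gt_at_top[of "0::real"] by eventually_elim (use \<xi> in auto)
    ultimately have "((\<lambda>t. ?f (t + 1) - ?f t) \<longlongrightarrow> (M *\<^sub>v l) $ i) at_top"
      by (rule Lim_transform_eventually)
    moreover have "((\<lambda>t. ?f (t + 1) - ?f t) \<longlongrightarrow> l $ i - l $ i) at_top"
      by (intro tendsto_diff xi i filterlim_compose[OF xi[OF i]]
          filterlim_at_top_mono[OF filterlim_ident]) auto
    ultimately have "(M *\<^sub>v l) $ i = l $ i - l $ i"
      by (rule tendsto_unique[OF trivial_limit_at_top_linorder])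
    then show ?thesis by simp
  qed
  then show ?thesis
    using M by (intro eq_vecI) auto
qed

lemma scalar_prod_self_real:
  fixes v :: "real vec"
  shows "v \<bullet> v \<ge> 0" and "v \<bullet> v = 0 \<Longrightarrow> v = 0\<^sub>v (dim_vec v)"
proof -
  show "v \<bullet> v \<ge> 0"
    by (auto simp: scalar_prod_def intro!: sum_nonneg)
  show "v = 0\<^sub>v (dim_vec v)" if "v \<bullet> v = 0"
    using that by (auto simp: scalar_prod_def sum_nonneg_eq_0_iff)
qed

text \<open>
  Evaluate the Riccati equation as a quadratic form at \<open>x\<close>. With \<open>y = B\<^sup>T P x\<close> the hypothesis reads
  \<open>A x = B y\<close>, so each of the three terms that involve \<open>P\<close> contributes \<open>y \<bullet> y\<close> up to sign, and what
  remains is \<open>y \<bullet> y + C x \<bullet> C x = 0\<close>. Hence \<open>y = 0\<close>: the optimal feedback vanishes at an equilibrium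
  of the closed loop.
\<close>

lemma closed_loop_kernel_subset_open_loop_kernel:
  assumes A: "A \<in> carrier_mat d d" and B: "B \<in> carrier_mat d p" and C: "C \<in> carrier_mat q d"
    and P: "psd_are_solution A B (transpose_mat C * C) P"
    and x: "x \<in> carrier_vec d" and ker: "(A - B * transpose_mat B * P) *\<^sub>v x = 0\<^sub>v d"
  shows "A *\<^sub>v x = 0\<^sub>v d"
proof -
  have Pc: "P \<in> carrier_mat d d" and sym: "transpose_mat P = P"
    and are: "transpose_mat A * P + P * A - P * B * transpose_mat B * P + transpose_mat C * C
       = 0\<^sub>m d d"
    using P A unfolding psd_are_solution_def psd_def by auto
  define y where "y = transpose_mat B *\<^sub>v (P *\<^sub>v x)"
  have y: "y \<in> carrier_vec p" and Px: "P *\<^sub>v x \<in> carrier_vec d"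
    using B Pc x unfolding y_def by auto
  have By: "(B * transpose_mat B * P) *\<^sub>v x = B *\<^sub>v y"
    using B Pc x unfolding y_def
    by (simp add: assoc_mult_mat_vec[of _ d p _ d] assoc_mult_mat_vec[of _ d d _ d])
  have diff0: "A *\<^sub>v x - B *\<^sub>v y = 0\<^sub>v d"
    using ker By A B Pc x by (simp add: minus_mult_distrib_mat_vec[of _ d d])
  have Ax: "A *\<^sub>v x = B *\<^sub>v y"
  proof (rule eq_vecI)
    fix i assume "i < dim_vec (B *\<^sub>v y)"
    then show "(A *\<^sub>v x) $ i = (B *\<^sub>v y) $ i"
      using arg_cong[OF diff0, of "\<lambda>v. v $ i"] A B by simp
  qed (use A B in auto)
  have PBy: "(P *\<^sub>v x) \<bullet> (B *\<^sub>v y) = y \<bullet> y"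
    using transpose_vec_mult_scalar[OF B y Px] by (simp add: y_def)
  have "0 = x \<bullet> ((transpose_mat A * P + P * A - P * B * transpose_mat B * P
      + transpose_mat C * C) *\<^sub>v x)"
  proof -
    have "0\<^sub>m d d *\<^sub>v x = 0\<^sub>v d" using x by (intro eq_vecI) auto
    then show ?thesis unfolding are using x by simp
  qed
  also have "(transpose_mat A * P + P * A - P * B * transpose_mat B * P
      + transpose_mat C * C) *\<^sub>v x
    = transpose_mat A *\<^sub>v (P *\<^sub>v x) + P *\<^sub>v (A *\<^sub>v x) - P *\<^sub>v (B *\<^sub>v y)
      + transpose_mat C *\<^sub>v (C *\<^sub>v x)"
  proof -
    have "(transpose_mat A * P) *\<^sub>v x = transpose_mat A *\<^sub>v (P *\<^sub>v x)"
      "(P * A) *\<^sub>v x = P *\<^sub>v (A *\<^sub>v x)"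
      "(transpose_mat C * C) *\<^sub>v x = transpose_mat C *\<^sub>v (C *\<^sub>v x)"
      using A C Pc x by (auto intro!: assoc_mult_mat_vec)
    moreover have "(P * B * transpose_mat B * P) *\<^sub>v x = P *\<^sub>v (B *\<^sub>v y)"
    proof -
      have "P * B * transpose_mat B = P * (B * transpose_mat B)"
        by (rule assoc_mult_mat) (use B Pc in auto)
      moreover have "P * (B * transpose_mat B) * P = P * (B * transpose_mat B * P)"
        by (rule assoc_mult_mat) (use B Pc in auto)
      ultimately have "P * B * transpose_mat B * P = P * (B * transpose_mat B * P)"
        by simp
      then show ?thesis
        using By B Pc x assoc_mult_mat_vec[of P d d "B * transpose_mat B * P" d x] by simp
    qed
    moreover have "transpose_mat A * P \<in> carrier_mat d d" "P * A \<in> carrier_mat d d"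
      "P * B * transpose_mat B * P \<in> carrier_mat d d" "transpose_mat C * C \<in> carrier_mat d d"
      using A B C Pc by auto
    moreover have "(X1 + X2 - X3 + X4) *\<^sub>v x = X1 *\<^sub>v x + X2 *\<^sub>v x - X3 *\<^sub>v x + X4 *\<^sub>v x"
      if X: "X1 \<in> carrier_mat d d" "X2 \<in> carrier_mat d d" "X3 \<in> carrier_mat d d" "X4 \<in> carrier_mat d d"
      for X1 X2 X3 X4
    proof -
      have "(X1 + X2 - X3 + X4) *\<^sub>v x = (X1 + X2 - X3) *\<^sub>v x + X4 *\<^sub>v x"
        by (rule add_mult_distrib_mat_vec) (use X x in auto)
      also have "(X1 + X2 - X3) *\<^sub>v x = (X1 + X2) *\<^sub>v x - X3 *\<^sub>v x"
        by (rule minus_mult_distrib_mat_vec) (use X x in auto)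
      also have "(X1 + X2) *\<^sub>v x = X1 *\<^sub>v x + X2 *\<^sub>v x"
        by (rule add_mult_distrib_mat_vec) (use X x in auto)
      finally show ?thesis .
    qed
    ultimately show ?thesis by metis
  qed
  also have "x \<bullet> \<dots> = x \<bullet> (transpose_mat A *\<^sub>v (P *\<^sub>v x)) + x \<bullet> (P *\<^sub>v (A *\<^sub>v x))
      - x \<bullet> (P *\<^sub>v (B *\<^sub>v y)) + x \<bullet> (transpose_mat C *\<^sub>v (C *\<^sub>v x))"
    using A B C Pc x y
    by (simp add: scalar_prod_add_distrib[of _ d] scalar_prod_minus_distrib[of _ d])
  also have "x \<bullet> (transpose_mat A *\<^sub>v (P *\<^sub>v x)) = y \<bullet> y"
    using transpose_vec_mult_scalar[OF A x Px] PBy Ax A Px x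
    by (metis comm_scalar_prod mult_mat_vec_carrier transpose_carrier_mat)
  also have "x \<bullet> (P *\<^sub>v (A *\<^sub>v x)) = y \<bullet> y"
    using transpose_vec_mult_scalar[OF Pc _ x, of "B *\<^sub>v y"] PBy Ax B y sym by simp
  also have "x \<bullet> (P *\<^sub>v (B *\<^sub>v y)) = y \<bullet> y"
    using transpose_vec_mult_scalar[OF Pc _ x, of "B *\<^sub>v y"] PBy B y sym by simp
  also have "x \<bullet> (transpose_mat C *\<^sub>v (C *\<^sub>v x)) = (C *\<^sub>v x) \<bullet> (C *\<^sub>v x)"
    using transpose_vec_mult_scalar[OF C x, of "C *\<^sub>v x"] C x
    by (metis comm_scalar_prod mult_mat_vec_carrier transpose_carrier_mat)
  finally have "y \<bullet> y = 0"
    using scalar_prod_self_real(1)[of y] scalar_prod_self_real(1)[of "C *\<^sub>v x"] by linarith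
  then have "y = 0\<^sub>v p"
    using scalar_prod_self_real(2)[of y] y by auto
  then show ?thesis
    using Ax B by auto
qed

text \<open>
  The upper half of an equilibrium of the extended system is an equilibrium of the original
  system, with the input that the exogenous state generates.
\<close>

lemma four_block_kernel_upper:
  fixes x :: "'a :: comm_ring_1 vec"
  assumes A: "A \<in> carrier_mat n n" and E: "E \<in> carrier_mat n k"
    and F: "F1 \<in> carrier_mat k n" "F2 \<in> carrier_mat k k"
    and x: "x \<in> carrier_vec (n + k)"
    and ker: "four_block_mat A E F1 F2 *\<^sub>v x = 0\<^sub>v (n + k)"
  shows "A *\<^sub>v vec_first x n + E *\<^sub>v vec_last x k = 0\<^sub>v n"
proof -
  let ?u = "A *\<^sub>v vec_first x n + E *\<^sub>v vec_last x k"
  let ?l = "F1 *\<^sub>v vec_first x n + F2 *\<^sub>v vec_last x k"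
  have "?u @\<^sub>v ?l = four_block_mat A E F1 F2 *\<^sub>v (vec_first x n @\<^sub>v vec_last x k)"
    by (rule four_block_mat_mult_vec[symmetric]) (use A E F in auto)
  also have "\<dots> = 0\<^sub>v n @\<^sub>v 0\<^sub>v k"
    using x ker by (auto intro!: eq_vecI)
  finally have "?u @\<^sub>v ?l = 0\<^sub>v n @\<^sub>v 0\<^sub>v k" .
  moreover have "?u \<in> carrier_vec n" using A E by auto
  ultimately show ?thesis
    using append_vec_eq[of ?u n "0\<^sub>v n" ?l "0\<^sub>v k"] by auto
qed

section \<open>Invertibility of the nonzero Jordan part\<close>

text \<open>
  Back substitution in the kernel equation of a Jordan block with eigenvalue \<open>z\<close>.
\<close>

lemma bidiagonal_recurrence_zero:
  fixes w :: "nat \<Rightarrow> complex"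
  assumes z: "z \<noteq> 0"
    and rec: "\<And>j. j < s \<Longrightarrow> z * w j + (if Suc j < s then w (Suc j) else 0) = 0"
    and j: "j < s"
  shows "w j = 0"
proof -
  have "\<forall>j. s - Suc i \<le> j \<and> j < s \<longrightarrow> w j = 0" for i
  proof (induction i)
    case 0
    show ?case
    proof (intro allI impI)
      fix j assume j: "s - Suc 0 \<le> j \<and> j < s"
      then have "\<not> Suc j < s" "j < s" by auto
      then show "w j = 0" using rec[of j] z by simp
    qed
  next
    case (Suc i)
    show ?case
    proof (intro allI impI)
      fix j assume j: "s - Suc (Suc i) \<le> j \<and> j < s"
      then have "Suc j < s \<Longrightarrow> w (Suc j) = 0" using Suc.IH by auto
      then show "w j = 0" using rec[of j] z j by (auto split: if_splits)
    qed
  qed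
  from this[of s] show ?thesis using j by auto
qed

lemma real_jordan_block_square:
  "square_mat (real_jordan_block s z)"
  by (auto simp: real_jordan_block_def)

text \<open>
  For a non-real eigenvalue \<open>z = a + \<i> b\<close>, pair the coordinates of a kernel vector into complex
  numbers \<open>w j = v (2 j) - \<i> v (2 j + 1)\<close>. The rows \<open>(a, b)\<close> and \<open>(-b, a)\<close> then combine into
  multiplication by \<open>z\<close>, so a kernel vector of the real block of size \<open>2 s\<close> is a kernel vector of the
  complex Jordan block of size \<open>s\<close>.
\<close>

lemma det_real_jordan_block_nonzero:
  assumes z: "z \<noteq> 0"
  shows "det (real_jordan_block s z) \<noteq> 0"
proof (cases "Im z = 0")
  case True
  then have "Re z \<noteq> 0" using z by (simp add: complex_eq_iff)
  moreover have "det (jordan_block s (Re z)) = prod_list (diag_mat (jordan_block s (Re z)))"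
    by (rule det_upper_triangular[of _ s]) (auto simp: upper_triangular_def)
  ultimately show ?thesis
    using True by (auto simp: real_jordan_block_def diag_mat_def prod_list_zero_iff)
next
  case False
  define J where "J = real_jordan_block s z"
  have J: "J \<in> carrier_mat (2 * s) (2 * s)"
    using False by (simp add: J_def real_jordan_block_def)
  have "v = 0\<^sub>v (2 * s)" if v: "v \<in> carrier_vec (2 * s)" and Jv: "J *\<^sub>v v = 0\<^sub>v (2 * s)" for v
  proof -
    \<comment> \<open>The minus sign makes the rows \<open>(a, b)\<close> and \<open>(-b, a)\<close> the real part and the negated imaginary part of \<open>z * w j\<close>.\<close>
    define w where "w j = Complex (v $ (2 * j)) (- v $ (2 * j + 1))" for j
    define nxt where "nxt j i = (if Suc j < s then v $ (2 * Suc j + i) else 0)" for j i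
    have row: "(\<Sum>l<2 * s. J $$ (i, l) * v $ l) = 0" if "i < 2 * s" for i
      using arg_cong[OF Jv, of "\<lambda>u. u $ i"] that J v
      by (simp add: scalar_prod_def atLeast0LessThan)
    have Jent: "J $$ (i, l) = (if i div 2 = l div 2 then
         (if i = l then Re z else if i < l then Im z else - Im z)
       else if Suc (i div 2) = l div 2 \<and> i mod 2 = l mod 2 then 1 else 0)"
      if "i < 2 * s" "l < 2 * s" for i l
      using that False by (simp add: J_def real_jordan_block_def)
    have pairs: "(\<Sum>l<2 * s. f l) = (\<Sum>l<s. f (2 * l) + f (2 * l + 1))" for f :: "nat \<Rightarrow> real"
      by (induction s) (simp_all add: algebra_simps)
    have even_row: "Re z * v $ (2 * j) + Im z * v $ (2 * j + 1) + nxt j 0 = 0" if j: "j < s" for j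
    proof -
      have "0 = (\<Sum>l<s. J $$ (2 * j, 2 * l) * v $ (2 * l) + J $$ (2 * j, 2 * l + 1) * v $ (2 * l + 1))"
        using row[of "2 * j"] j pairs by simp
      also have "\<dots> = (\<Sum>l<s. (if l = j then Re z * v $ (2 * j) + Im z * v $ (2 * j + 1) else 0)
          + (if l = Suc j then v $ (2 * Suc j) else 0))"
        by (rule sum.cong) (use j in \<open>auto simp: Jent\<close>)
      also have "\<dots> = Re z * v $ (2 * j) + Im z * v $ (2 * j + 1) + nxt j 0"
        using j by (simp add: sum.distrib nxt_def)
      finally show ?thesis by simp
    qed
    have odd_row: "- Im z * v $ (2 * j) + Re z * v $ (2 * j + 1) + nxt j 1 = 0" if j: "j < s" for j
    proof -
      have "0 = (\<Sum>l<s. J $$ (2 * j + 1, 2 * l) * v $ (2 * l) + J $$ (2 * j + 1, 2 * l + 1) * v $ (2 * l + 1))"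
        using row[of "2 * j + 1"] j pairs by simp
      also have "\<dots> = (\<Sum>l<s. (if l = j then - Im z * v $ (2 * j) + Re z * v $ (2 * j + 1) else 0)
          + (if l = Suc j then v $ (2 * Suc j + 1) else 0))"
        by (rule sum.cong) (use j in \<open>auto simp: Jent mod_Suc\<close>)
      also have "\<dots> = - Im z * v $ (2 * j) + Re z * v $ (2 * j + 1) + nxt j 1"
        using j by (simp add: sum.distrib nxt_def)
      finally show ?thesis by simp
    qed
    have w0: "w j = 0" if "j < s" for j
    proof (rule bidiagonal_recurrence_zero[OF z _ that])
      fix j assume j: "j < s"
      show "z * w j + (if Suc j < s then w (Suc j) else 0) = 0"
        using even_row[OF j] odd_row[OF j]
        by (auto simp: w_def nxt_def complex_eq_iff algebra_simps)
    qed
    show ?thesis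
    proof (rule eq_vecI)
      fix i assume "i < dim_vec (0\<^sub>v (2 * s))"
      then have i: "i < 2 * s" by simp
      then have "w (i div 2) = 0" by (intro w0) auto
      then have "v $ (2 * (i div 2)) = 0" "v $ (2 * (i div 2) + 1) = 0"
        by (auto simp: w_def complex_eq_iff)
      moreover have "i = 2 * (i div 2) \<or> i = 2 * (i div 2) + 1" by presburger
      ultimately show "v $ i = 0\<^sub>v (2 * s) $ i" using i by (metis index_zero_vec(1))
    qed (use v in auto)
  qed
  then show ?thesis
    using det_0_iff_vec_prod_zero[OF J] unfolding J_def by blast
qed

lemma det_diag_block_mat:
  fixes Ms :: "'a :: idom mat list"
  assumes "\<And>M. M \<in> set Ms \<Longrightarrow> square_mat M"
  shows "det (diag_block_mat Ms) = prod_list (map det Ms)"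
  using assms
proof (induction Ms)
  case (Cons M Ms)
  obtain a where M: "M \<in> carrier_mat a a"
    using Cons.prems[of M] by (auto simp: square_mat.simps)
  have "square_mat (diag_block_mat Ms)"
    using Cons.prems by (intro diag_block_mat_square) auto
  then obtain b where D: "diag_block_mat Ms \<in> carrier_mat b b"
    by (auto simp: square_mat.simps)
  have "det (diag_block_mat (M # Ms))
      = det (four_block_mat M (0\<^sub>m a b) (0\<^sub>m b a) (diag_block_mat Ms))"
    using M D by (simp only: diag_block_mat.simps Let_def carrier_matD)
  also have "\<dots> = det M * det (diag_block_mat Ms)"
    by (rule det_four_block_mat_lower_left_zero[OF M _ refl D]) simp
  finally show ?case
    using Cons by simp
qed simp

lemma mat_inverse_right:
  fixes M :: "'a :: field mat"
  assumes M: "M \<in> carrier_mat d d" and "det M \<noteq> 0"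
  shows "the (mat_inverse M) \<in> carrier_mat d d" and "M * the (mat_inverse M) = 1\<^sub>m d"
proof -
  have "mat_inverse M \<noteq> None"
    using mat_inverse(1)[OF M, of "()"] det_non_zero_imp_unit[OF assms, of "()"] by blast
  then show "the (mat_inverse M) \<in> carrier_mat d d" "M * the (mat_inverse M) = 1\<^sub>m d"
    using mat_inverse(2)[OF M] by auto
qed

section \<open>Block diagonal matrices and stacked blocks\<close>

lemma append_rows_mult:
  fixes U :: "'a :: comm_semiring_0 mat"
  assumes A: "A \<in> carrier_mat nr1 nc" and B: "B \<in> carrier_mat nr2 nc"
    and U: "U \<in> carrier_mat nc c"
  shows "(A @\<^sub>r B) * U = (A * U) @\<^sub>r (B * U)"
proof -
  have "U = four_block_mat U (0\<^sub>m nc 0) (0\<^sub>m 0 c) (0\<^sub>m 0 0)"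
    using U by (intro eq_matI) auto
  then have "(A @\<^sub>r B) * U = four_block_mat A (0\<^sub>m nr1 0) B (0\<^sub>m nr2 0)
      * four_block_mat U (0\<^sub>m nc 0) (0\<^sub>m 0 c) (0\<^sub>m 0 0)"
    using A B by (simp add: append_rows_def)
  also have "\<dots> = four_block_mat (A * U + 0\<^sub>m nr1 0 * 0\<^sub>m 0 c) (A * 0\<^sub>m nc 0 + 0\<^sub>m nr1 0 * 0\<^sub>m 0 0)
      (B * U + 0\<^sub>m nr2 0 * 0\<^sub>m 0 c) (B * 0\<^sub>m nc 0 + 0\<^sub>m nr2 0 * 0\<^sub>m 0 0)"
    by (rule mult_four_block_mat) (use A B U in auto)
  also have "\<dots> = (A * U) @\<^sub>r (B * U)"
    unfolding append_rows_def
    by (rule cong_four_block_mat) (use A B U in \<open>auto intro!: eq_matI\<close>)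
  finally show ?thesis .
qed

lemma stack_rows_carrier:
  assumes "\<And>N. N \<in> set Ns \<Longrightarrow> dim_col N = c"
  shows "stack_rows c Ns \<in> carrier_mat (sum_list (map dim_row Ns)) c"
  using assms
proof (induction Ns)
  case (Cons N Ns)
  have "N \<in> carrier_mat (dim_row N) c" using Cons.prems[of N] by auto
  moreover have "stack_rows c Ns \<in> carrier_mat (sum_list (map dim_row Ns)) c"
    using Cons.prems by (intro Cons.IH) auto
  ultimately have "N @\<^sub>r stack_rows c Ns \<in> carrier_mat (dim_row N + sum_list (map dim_row Ns)) c"
    by (rule carrier_append_rows)
  then show ?case by (simp add: stack_rows_def)
qed (simp add: stack_rows_def)

lemma stack_rows_mult:
  fixes U :: "'a :: comm_semiring_0 mat"
  assumes "\<And>N. N \<in> set Ns \<Longrightarrow> dim_col N = c" and U: "U \<in> carrier_mat c c'"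
  shows "stack_rows c Ns * U = stack_rows c' (map (\<lambda>N. N * U) Ns)"
  using assms(1)
proof (induction Ns)
  case Nil
  then show ?case using U by (auto simp: stack_rows_def)
next
  case (Cons N Ns)
  have "N \<in> carrier_mat (dim_row N) c" using Cons.prems[of N] by auto
  from append_rows_mult[OF this stack_rows_carrier[of Ns c] U] Cons show ?case
    by (simp add: stack_rows_def)
qed

text \<open>
  The relation in the hypothesis, also used below, says that the square blocks on the diagonal are
  aligned with the stacked blocks, each of width \<open>c\<close>.
\<close>

lemma conformal_blocks_carrier:
  fixes Ms :: "'a :: zero mat list"
  assumes "list_all2 (\<lambda>M N. M \<in> carrier_mat (dim_row N) (dim_row N) \<and> dim_col N = c) Ms Ns"
  defines "b \<equiv> sum_list (map dim_row Ns)"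
  shows "diag_block_mat Ms \<in> carrier_mat b b" and "stack_rows c Ns \<in> carrier_mat b c"
proof -
  have "map dim_row Ms = map dim_row Ns" "map dim_col Ms = map dim_row Ns"
    using assms by (auto simp: list_all2_conv_all_nth intro!: nth_equalityI)
  then show "diag_block_mat Ms \<in> carrier_mat b b"
    by (auto simp: b_def dim_diag_block_mat)
  show "stack_rows c Ns \<in> carrier_mat b c"
    unfolding b_def
    by (rule stack_rows_carrier) (use assms(1) in \<open>auto simp: list_all2_conv_all_nth in_set_conv_nth\<close>)
qed

lemma diag_block_mat_mult_stack_rows:
  fixes Ms :: "'a :: comm_semiring_0 mat list"
  assumes "list_all2 (\<lambda>M N. M \<in> carrier_mat (dim_row N) (dim_row N) \<and> dim_col N = c) Ms Ns"
  shows "diag_block_mat Ms * stack_rows c Ns = stack_rows c (map2 (*) Ms Ns)"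
  using assms
proof (induction rule: list_all2_induct)
  case Nil
  then show ?case by (auto simp: stack_rows_def)
next
  case (Cons M Ms N Ns)
  define D S where "D = diag_block_mat Ms" and "S = stack_rows c Ns"
  obtain a where M: "M \<in> carrier_mat a a" and N: "N \<in> carrier_mat a c"
    using Cons by auto
  define b where "b = sum_list (map dim_row Ns)"
  note D = conformal_blocks_carrier(1)[OF Cons.hyps(2), folded b_def D_def]
    and S = conformal_blocks_carrier(2)[OF Cons.hyps(2), folded b_def S_def]
  have "diag_block_mat (M # Ms) * stack_rows c (N # Ns)
      = four_block_mat M (0\<^sub>m a b) (0\<^sub>m b a) D * four_block_mat N (0\<^sub>m a 0) S (0\<^sub>m b 0)"
  proof -
    have "stack_rows c (N # Ns) = N @\<^sub>r S" by (simp add: S_def stack_rows_def)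
    moreover have "diag_block_mat (M # Ms)
        = four_block_mat M (0\<^sub>m (dim_row M) (dim_col D)) (0\<^sub>m (dim_row D) (dim_col M)) D"
      by (simp add: D_def Let_def)
    ultimately show ?thesis
      using M N D S by (simp add: append_rows_def)
  qed
  also have "\<dots> = four_block_mat (M * N + 0\<^sub>m a b * S) (M * 0\<^sub>m a 0 + 0\<^sub>m a b * 0\<^sub>m b 0)
      (0\<^sub>m b a * N + D * S) (0\<^sub>m b a * 0\<^sub>m a 0 + D * 0\<^sub>m b 0)"
    by (rule mult_four_block_mat) (use M N D S in auto)
  also have "\<dots> = (M * N) @\<^sub>r (D * S)"
    unfolding append_rows_def
    by (rule cong_four_block_mat) (use M N D S in \<open>auto intro!: eq_matI\<close>)
  also have "\<dots> = stack_rows c (map2 (*) (M # Ms) (N # Ns))"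
    using Cons.IH by (simp add: D_def S_def stack_rows_def)
  finally show ?case .
qed

text \<open>
  Each diagonal block acts on its own segment of \<open>x\<close>, so an equilibrium equation for the whole system
  decouples into one equation for each block, coupled only through the common input \<open>u\<close>.
\<close>

lemma diag_block_mat_stack_rows_blockwise:
  fixes Ms Ns :: "'a :: comm_ring_1 mat list"
  assumes "list_all2 (\<lambda>M N. M \<in> carrier_mat (dim_row N) (dim_row N) \<and> dim_col N = m) Ms Ns"
    and "x \<in> carrier_vec (sum_list (map dim_row Ns))" and u: "u \<in> carrier_vec m"
    and "diag_block_mat Ms *\<^sub>v x + stack_rows m Ns *\<^sub>v u = 0\<^sub>v (sum_list (map dim_row Ns))"
    and "i < length Ns"
  shows "\<exists>\<xi> \<in> carrier_vec (dim_row (Ns ! i)).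
    Ms ! i *\<^sub>v \<xi> + Ns ! i *\<^sub>v u = 0\<^sub>v (dim_row (Ns ! i))"
  using assms(1,2,4,5)
proof (induction arbitrary: x i rule: list_all2_induct)
  case (Cons M Ms N Ns)
  define D S where "D = diag_block_mat Ms" and "S = stack_rows m Ns"
  obtain a where M: "M \<in> carrier_mat a a" and N: "N \<in> carrier_mat a m"
    using Cons by auto
  define b where "b = sum_list (map dim_row Ns)"
  note D = conformal_blocks_carrier(1)[OF Cons.hyps(2), folded b_def D_def]
    and S = conformal_blocks_carrier(2)[OF Cons.hyps(2), folded b_def S_def]
  define v w where "v = vec_first x a" and "w = vec_last x b"
  have v: "v \<in> carrier_vec a" and w: "w \<in> carrier_vec b" and x_eq: "x = v @\<^sub>v w"
    using Cons.prems(1) N by (simp_all add: v_def w_def b_def)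
  have "diag_block_mat (M # Ms) *\<^sub>v x
      = four_block_mat M (0\<^sub>m a b) (0\<^sub>m b a) D *\<^sub>v (v @\<^sub>v w)"
    using M D by (simp add: D_def[symmetric] Let_def x_eq)
  also have "\<dots> = (M *\<^sub>v v + 0\<^sub>m a b *\<^sub>v w) @\<^sub>v (0\<^sub>m b a *\<^sub>v v + D *\<^sub>v w)"
    by (rule four_block_mat_mult_vec) (use M D v w in auto)
  also have "\<dots> = (M *\<^sub>v v) @\<^sub>v (D *\<^sub>v w)"
    using M D v w by (intro eq_vecI) auto
  finally have "diag_block_mat (M # Ms) *\<^sub>v x = (M *\<^sub>v v) @\<^sub>v (D *\<^sub>v w)" .
  moreover have "stack_rows m (N # Ns) *\<^sub>v u = (N *\<^sub>v u) @\<^sub>v (S *\<^sub>v u)"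
    using mat_mult_append[OF N S u] by (simp add: S_def stack_rows_def)
  moreover have "0\<^sub>v (sum_list (map dim_row (N # Ns))) = 0\<^sub>v a @\<^sub>v (0\<^sub>v b :: 'a vec)"
    using N by (intro eq_vecI) (auto simp: b_def)
  moreover have "((M *\<^sub>v v) @\<^sub>v (D *\<^sub>v w)) + ((N *\<^sub>v u) @\<^sub>v (S *\<^sub>v u))
      = (M *\<^sub>v v + N *\<^sub>v u) @\<^sub>v (D *\<^sub>v w + S *\<^sub>v u)"
    by (rule append_vec_add[of _ a _ _ b]) (use M N D S v w u in auto)
  ultimately have "(M *\<^sub>v v + N *\<^sub>v u) @\<^sub>v (D *\<^sub>v w + S *\<^sub>v u) = 0\<^sub>v a @\<^sub>v 0\<^sub>v b"
    using Cons.prems(2) by simp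
  moreover have "M *\<^sub>v v + N *\<^sub>v u \<in> carrier_vec a"
    using M N v u by auto
  ultimately have head: "M *\<^sub>v v + N *\<^sub>v u = 0\<^sub>v a" and tail: "D *\<^sub>v w + S *\<^sub>v u = 0\<^sub>v b"
    using append_vec_eq[of "M *\<^sub>v v + N *\<^sub>v u" a "0\<^sub>v a" "D *\<^sub>v w + S *\<^sub>v u" "0\<^sub>v b"] by auto
  show ?case
  proof (cases i)
    case 0
    then show ?thesis using head v N by auto
  next
    case (Suc j)
    then show ?thesis
      using Cons.IH[of w j] w tail Cons.prems(3) by (simp add: D_def S_def b_def)
  qed
qed simp

section \<open>Equilibrium equations of nilpotent Jordan blocks\<close>

lemma last_row_carrier: "M \<in> carrier_mat r m \<Longrightarrow> last_row M \<in> carrier_vec m"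
  by (intro carrier_vecI) (simp add: last_row_def)

text \<open>
  A nilpotent Jordan block shifts rows up by one and puts zero in the last row. It therefore
  undoes the shift down by one in \<open>X_tilde_block\<close>, and the last row of \<open>Bi * U\<close> is the only
  obstruction to solving the equation.
\<close>

lemma nilpotent_jordan_block_mult_X_tilde_block:
  assumes Bi: "Bi \<in> carrier_mat r m" and U: "U \<in> carrier_mat m c" and r: "r \<ge> 1"
    and last: "\<And>j. j < c \<Longrightarrow> last_row Bi \<bullet> col U j = 0"
  shows "X_tilde_block Bi U \<in> carrier_mat r c"
    and "jordan_block r 0 * X_tilde_block Bi U = Bi * U"
proof -
  have top: "init_rows Bi * U \<in> carrier_mat (r - 1) c"
    using Bi U by (auto simp: init_rows_def)
  show X: "X_tilde_block Bi U \<in> carrier_mat r c"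
    using carrier_append_rows[OF zero_carrier_mat[of 1 c] top] U r by (simp add: X_tilde_block_def)
  show "jordan_block r 0 * X_tilde_block Bi U = Bi * U"
  proof (rule eq_matI)
    fix i j assume "i < dim_row (Bi * U)" "j < dim_col (Bi * U)"
    then have i: "i < r" and j: "j < c" using Bi U by auto
    have "(jordan_block r 0 * X_tilde_block Bi U) $$ (i, j)
        = (\<Sum>l<r. (if Suc i = l then 1 else 0) * X_tilde_block Bi U $$ (l, j))"
      using i j X by (auto simp: scalar_prod_def atLeast0LessThan intro!: sum.cong)
    also have "\<dots> = (\<Sum>l<r. if l = Suc i then X_tilde_block Bi U $$ (l, j) else 0)"
      by (rule sum.cong) auto
    also have "\<dots> = (if Suc i < r then X_tilde_block Bi U $$ (Suc i, j) else 0)"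
      by simp
    also have "\<dots> = row Bi i \<bullet> col U j"
    proof (cases "Suc i < r")
      case True
      have "row (init_rows Bi) i = row Bi i"
        using True Bi by (intro eq_vecI) (auto simp: init_rows_def)
      then have "X_tilde_block Bi U $$ (Suc i, j) = row Bi i \<bullet> col U j"
        using True j U top Bi by (simp add: X_tilde_block_def append_rows_def init_rows_def)
      then show ?thesis using True by simp
    next
      case False
      then have "last_row Bi = row Bi i"
        using i Bi by (auto simp: last_row_def intro!: arg_cong[of _ _ "row Bi"])
      then show ?thesis using False last[OF j] by simp
    qed
    finally show "(jordan_block r 0 * X_tilde_block Bi U) $$ (i, j) = (Bi * U) $$ (i, j)"
      using i j Bi U by simp
  qed (use X Bi U in auto)
qed

text \<open>
  This identity explains the shape of the left half \<open>L\<close> of \<open>X_tilde\<close>: applied to \<open>y\<close>, it is a state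
  that solves \<open>A x = B U y\<close>. The invertible part of \<open>A\<close> is solved by the inverse of \<open>Ar\<close>, each nilpotent
  block by shifting down, and the right-hand side is admissible because the columns of \<open>U\<close>
  are annihilated by \<open>B_last\<close>.
\<close>

lemma X_tilde_left_block:
  fixes Ar Br U :: "real mat" and Bs :: "real mat list"
  assumes Ar: "Ar \<in> carrier_mat r0 r0" "det Ar \<noteq> 0"
    and zero_blocks: "\<forall>r \<in> set rs. r \<ge> 1"
    and Br: "Br \<in> carrier_mat r0 m"
    and Bs: "length Bs = length rs" "\<forall>j < length rs. Bs ! j \<in> carrier_mat (rs ! j) m"
    and U: "U \<in> carrier_mat m c"
    and last: "\<And>j. j < c \<Longrightarrow> B_last m Bs *\<^sub>v col U j = 0\<^sub>v (length Bs)"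
  defines "L \<equiv> stack_rows c (the (mat_inverse Ar) * Br * U # map (\<lambda>Bi. X_tilde_block Bi U) Bs)"
  shows "L \<in> carrier_mat (r0 + sum_list rs) c"
    and "diag_block_mat (Ar # map (\<lambda>r. jordan_block r 0) rs) * L = stack_rows m (Br # Bs) * U"
proof -
  let ?Ai = "the (mat_inverse Ar)"
  note Ai = mat_inverse_right[OF Ar]
  have last_row: "last_row (Bs ! i) \<bullet> col U j = 0" if "i < length rs" "j < c" for i j
  proof -
    have "last_row (Bs ! i) \<in> carrier_vec m"
      using Bs that last_row_carrier by blast
    then have "row (B_last m Bs) i = last_row (Bs ! i)"
      using Bs that by (auto simp: B_last_def)
    then show ?thesis
      using arg_cong[OF last[OF that(2)], of "\<lambda>v. v $ i"] Bs that by (auto simp: B_last_def)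
  qed
  have block: "X_tilde_block (Bs ! i) U \<in> carrier_mat (rs ! i) c"
    "jordan_block (rs ! i) 0 * X_tilde_block (Bs ! i) U = Bs ! i * U" if "i < length rs" for i
    using nilpotent_jordan_block_mult_X_tilde_block[of "Bs ! i" "rs ! i" m U c]
      Bs U zero_blocks last_row that by auto
  have top: "?Ai * Br * U \<in> carrier_mat r0 c"
    using Ai Br U by auto
  let ?Ms = "Ar # map (\<lambda>r. jordan_block r 0) rs"
  let ?Ns = "?Ai * Br * U # map (\<lambda>Bi. X_tilde_block Bi U) Bs"
  have conformal: "list_all2 (\<lambda>M N. M \<in> carrier_mat (dim_row N) (dim_row N) \<and> dim_col N = c) ?Ms ?Ns"
  proof -
    have "dim_row (X_tilde_block (Bs ! i) U) = rs ! i" "dim_col (X_tilde_block (Bs ! i) U) = c"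
      if "i < length rs" for i
      using block(1)[OF that] by auto
    then have "list_all2 (\<lambda>M N. M \<in> carrier_mat (dim_row N) (dim_row N) \<and> dim_col N = c)
        (map (\<lambda>r. jordan_block r (0 :: real)) rs) (map (\<lambda>Bi. X_tilde_block Bi U) Bs)"
      unfolding list_all2_conv_all_nth using Bs by auto
    then show ?thesis
      using Ar(1) Ai(1) U by simp
  qed
  have "map (\<lambda>Bi. dim_row (X_tilde_block Bi U)) Bs = rs"
    using block Bs by (intro nth_equalityI) auto
  then have "sum_list (map dim_row ?Ns) = r0 + sum_list rs"
    using Ai(1) by (simp add: comp_def)
  then show "L \<in> carrier_mat (r0 + sum_list rs) c"
    using conformal_blocks_carrier(2)[OF conformal] by (simp only: L_def)
  have "diag_block_mat ?Ms * L = stack_rows c (map2 (*) ?Ms ?Ns)"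
    unfolding L_def by (rule diag_block_mat_mult_stack_rows[OF conformal])
  also have "map2 (*) ?Ms ?Ns = map (\<lambda>N. N * U) (Br # Bs)"
  proof -
    have "Ar * (?Ai * Br * U) = Ar * (?Ai * (Br * U))"
      using Ai Br U by simp
    also have "\<dots> = Ar * ?Ai * (Br * U)"
      by (rule assoc_mult_mat[symmetric]) (use Ar Ai Br U in auto)
    also have "\<dots> = Br * U"
      using Ai Br U by simp
    finally have "Ar * (?Ai * Br * U) = Br * U" .
    moreover have "map2 (*) (map (\<lambda>r. jordan_block r 0) rs) (map (\<lambda>Bi. X_tilde_block Bi U) Bs)
        = map (\<lambda>N. N * U) Bs"
      by (rule nth_equalityI) (use block Bs in auto)
    ultimately show ?thesis by simp
  qed
  also have "stack_rows c (map (\<lambda>N. N * U) (Br # Bs)) = stack_rows m (Br # Bs) * U"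
    by (rule stack_rows_mult[symmetric]) (use Br Bs U in \<open>auto simp: in_set_conv_nth\<close>)
  finally show "diag_block_mat ?Ms * L = stack_rows m (Br # Bs) * U" .
qed

text \<open>
  The last row of a nilpotent Jordan block is zero, so the last row of each decoupled equation
  constrains the input alone. These constraints together say that \<open>u\<close> lies in the kernel of
  \<open>B_last\<close>.
\<close>

lemma B_last_mult_eq_0:
  assumes Ar: "Ar \<in> carrier_mat r0 r0"
    and zero_blocks: "\<forall>r \<in> set rs. r \<ge> 1"
    and Br: "Br \<in> carrier_mat r0 m"
    and Bs: "length Bs = length rs" "\<forall>j < length rs. Bs ! j \<in> carrier_mat (rs ! j) m"
    and x: "x \<in> carrier_vec (r0 + sum_list rs)" and u: "u \<in> carrier_vec m"
    and eq: "diag_block_mat (Ar # map (\<lambda>r. jordan_block r 0) rs) *\<^sub>v x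
      + stack_rows m (Br # Bs) *\<^sub>v u = 0\<^sub>v (r0 + sum_list rs)"
  shows "B_last m Bs *\<^sub>v u = 0\<^sub>v (length Bs)"
proof (rule eq_vecI)
  fix i assume "i < dim_vec (0\<^sub>v (length Bs) :: real vec)"
  then have i: "i < length rs" using Bs by simp
  let ?r = "rs ! i"
  have r: "?r \<ge> 1" and Bi: "Bs ! i \<in> carrier_mat ?r m"
    using i zero_blocks Bs by auto
  have dims: "map dim_row Bs = rs"
    using Bs by (intro nth_equalityI) auto
  have "\<exists>\<xi> \<in> carrier_vec (dim_row ((Br # Bs) ! Suc i)).
      (Ar # map (\<lambda>r. jordan_block r 0) rs) ! Suc i *\<^sub>v \<xi> + (Br # Bs) ! Suc i *\<^sub>v u
        = 0\<^sub>v (dim_row ((Br # Bs) ! Suc i))"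
  proof (rule diag_block_mat_stack_rows_blockwise[OF _ _ u])
    show "list_all2 (\<lambda>M N. M \<in> carrier_mat (dim_row N) (dim_row N) \<and> dim_col N = m)
        (Ar # map (\<lambda>r. jordan_block r 0) rs) (Br # Bs)"
    proof -
      have "list_all2 (\<lambda>M N. M \<in> carrier_mat (dim_row N) (dim_row N) \<and> dim_col N = m)
        (map (\<lambda>r. jordan_block r (0 :: real)) rs) Bs"
        unfolding list_all2_conv_all_nth using Bs by auto
      then show ?thesis
        using Ar Br by simp
    qed
  qed (use x eq dims Br Bs i in auto)
  then obtain \<xi> where \<xi>: "\<xi> \<in> carrier_vec ?r"
    and eq_i: "jordan_block ?r 0 *\<^sub>v \<xi> + Bs ! i *\<^sub>v u = 0\<^sub>v ?r"
    using i Bi by auto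
  have "row (jordan_block ?r (0::real)) (?r - 1) = 0\<^sub>v ?r"
    using r by (intro eq_vecI) auto
  then have "(jordan_block ?r 0 *\<^sub>v \<xi>) $ (?r - 1) = 0"
    using r \<xi> by simp
  then have "last_row (Bs ! i) \<bullet> u = 0"
    using arg_cong[OF eq_i, of "\<lambda>v. v $ (?r - 1)"] r Bi by (simp add: last_row_def)
  moreover have "last_row (Bs ! i) \<in> carrier_vec m"
    using Bi by (rule last_row_carrier)
  ultimately show "(B_last m Bs *\<^sub>v u) $ i = 0\<^sub>v (length Bs) $ i"
    using i Bs by (simp add: B_last_def)
qed (simp add: B_last_def)

section \<open>Column spaces and linear independence of columns\<close>

lemma col_space_eq_range:
  assumes "(M :: real mat) \<in> carrier_mat d c"
  shows "vec_space.col_space d M = {M *\<^sub>v v | v. v \<in> carrier_vec c}"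
proof -
  interpret vec_space "TYPE(real)" d .
  show ?thesis using col_space_eq[OF assms] assms by auto
qed

text \<open>
  Two equal columns \<open>i\<close> and \<open>j\<close> would put the nonzero vector \<open>e\<^sub>i - e\<^sub>j\<close> into the kernel. This accounts
  for the distinctness of the columns. For distinct columns, linear relations are kernel vectors.
\<close>

lemma lin_indpt_cols_iff_injective:
  assumes M: "M \<in> carrier_mat d c"
  shows "lin_indpt_cols M \<longleftrightarrow> (\<forall>v \<in> carrier_vec c. M *\<^sub>v v = 0\<^sub>v d \<longrightarrow> v = 0\<^sub>v c)"
proof -
  interpret vec_space "TYPE(real)" d .
  have "distinct (cols M)" if inj: "\<forall>v \<in> carrier_vec c. M *\<^sub>v v = 0\<^sub>v d \<longrightarrow> v = 0\<^sub>v c"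
  proof -
    have "col M i \<noteq> col M j" if ij: "i < c" "j < c" "i \<noteq> j" for i j
    proof
      have unit: "M *\<^sub>v unit_vec c l = col M l" if "l < c" for l
        using M that by (intro eq_vecI) auto
      assume eq: "col M i = col M j"
      have "M *\<^sub>v (unit_vec c i - unit_vec c j) = col M i - col M j"
        using M ij by (simp add: mult_minus_distrib_mat_vec[of _ d c] unit)
      then have "unit_vec c i - unit_vec c j = (0\<^sub>v c :: real vec)"
        using inj eq M ij by auto
      from arg_cong[OF this, of "\<lambda>v. v $ i"] show False
        using ij by simp
    qed
    then show ?thesis
      using M by (auto simp: distinct_conv_nth)
  qed
  then show ?thesis
    unfolding lin_indpt_cols_def carrier_matD(1)[OF M]
    using lin_depI[OF M] lin_depE[OF M] by metis
qed

lemma orthonormal_cols_injective: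
  assumes U: "U \<in> carrier_mat d c" and on: "orthonormal_basis_cols U W"
    and v: "v \<in> carrier_vec c" and Uv: "U *\<^sub>v v = 0\<^sub>v d"
  shows "v = 0\<^sub>v c"
proof -
  have "transpose_mat U * U = 1\<^sub>m c"
    using U on by (intro eq_matI) (auto simp: orthonormal_basis_cols_def)
  then have "v = transpose_mat U *\<^sub>v (U *\<^sub>v v)"
    using U v assoc_mult_mat_vec[of "transpose_mat U" c d U c v] by simp
  then show ?thesis using Uv U by auto
qed

lemma append_cols_mat_mult_vec:
  fixes M :: "'a :: comm_ring_1 mat"
  assumes M: "M \<in> carrier_mat d a" and N: "N \<in> carrier_mat d b"
    and v: "v \<in> carrier_vec a" and w: "w \<in> carrier_vec b"
  shows "append_cols_mat M N *\<^sub>v (v @\<^sub>v w) = M *\<^sub>v v + N *\<^sub>v w"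
proof -
  have "append_cols_mat M N *\<^sub>v (v @\<^sub>v w)
      = (M *\<^sub>v v + N *\<^sub>v w) @\<^sub>v (0\<^sub>m 0 a *\<^sub>v v + 0\<^sub>m 0 b *\<^sub>v w)"
    unfolding append_cols_mat_def carrier_matD(2)[OF M] carrier_matD(2)[OF N]
    by (rule four_block_mat_mult_vec[OF M N _ _ v w]) auto
  also have "\<dots> = M *\<^sub>v v + N *\<^sub>v w"
    using M N by (intro eq_vecI) auto
  finally show ?thesis .
qed

lemma append_cols_mat_carrier:
  assumes "M \<in> carrier_mat d a" and "N \<in> carrier_mat d b"
  shows "append_cols_mat M N \<in> carrier_mat d (a + b)"
  using assms unfolding append_cols_mat_def by auto

section \<open>The maximal steady-state space\<close>

theorem theorem1:
  fixes n m k p q r0 :: nat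
    and A B C Ar Br F1 F2 G H K :: "real mat"
    and nonzero_blocks :: "(nat \<times> complex) list"
    and rs :: "nat list" and Bs :: "real mat list"
    and Abar Bbar Cbar P U_B U_A :: "real mat"
    and x0 xbar_ss :: "real vec"
  assumes nonzero_blocks: "\<forall>(s, z) \<in> set nonzero_blocks. s \<ge> 1 \<and> z \<noteq> 0"
    and Ar: "Ar = diag_block_mat (map (\<lambda>(s, z). real_jordan_block s z) nonzero_blocks)"
      "Ar \<in> carrier_mat r0 r0"
    and zero_blocks: "\<forall>r \<in> set rs. r \<ge> 1"
    and A: "A = diag_block_mat (Ar # map (\<lambda>r. jordan_block r 0) rs)"
      "A \<in> carrier_mat n n"
    and Br: "Br \<in> carrier_mat r0 m"
    and Bs: "length Bs = length rs" "\<forall>j < length rs. Bs ! j \<in> carrier_mat (rs ! j) m"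
    and B: "B = stack_rows m (Br # Bs)"
    and C: "C \<in> carrier_mat q n"
    and exo: "F1 \<in> carrier_mat k n" "F2 \<in> carrier_mat k k" "G \<in> carrier_mat k p"
      "H \<in> carrier_mat m k" "K \<in> carrier_mat m p"
    and Abar: "Abar = four_block_mat A (B * H) F1 F2"
    and Bbar: "Bbar = (B * K) @\<^sub>r G"
    and Cbar: "Cbar = append_cols_mat C (0\<^sub>m q k)"
    and stabilizable: "stabilizable Abar Bbar"
    and undetectable: "{z. undetectable_eigenvalue Cbar Abar z} = {0}"
    and semisimple: "undetectable_zero_semisimple Cbar Abar"
    and P: "smallest_psd_are_solution Abar Bbar (transpose_mat Cbar * Cbar) P"
    and steady: "steady_state (Abar - Bbar * transpose_mat Bbar * P) x0 xbar_ss"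
    and U_B: "dim_row U_B = m" "orthonormal_basis_cols U_B (mat_kernel (B_last m Bs))"
    and U_A: "dim_row U_A = n" "orthonormal_basis_cols U_A (mat_kernel A)"
  shows "vec_first xbar_ss n \<in> vec_space.col_space n (X_tilde Ar Br Bs U_B U_A)
    \<and> (lin_indpt_cols B \<longrightarrow> lin_indpt_cols (X_tilde Ar Br Bs U_B U_A))"
proof -
  define b a where "b = dim_col U_B" and "a = dim_col U_A"
  have UB: "U_B \<in> carrier_mat m b" and UA: "U_A \<in> carrier_mat n a"
    using U_B(1) U_A(1) by (auto simp: b_def a_def)
  have Bl: "B_last m Bs \<in> carrier_mat (length Bs) m"
    by (auto simp: B_last_def)
  have kerB: "mat_kernel (B_last m Bs) = {U_B *\<^sub>v v | v. v \<in> carrier_vec b}"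
    using U_B(2) col_space_eq_range[OF UB] U_B(1) by (simp add: orthonormal_basis_cols_def)
  have kerA: "mat_kernel A = {U_A *\<^sub>v v | v. v \<in> carrier_vec a}"
    using U_A(2) col_space_eq_range[OF UA] U_A(1) by (simp add: orthonormal_basis_cols_def)
  have det_Ar: "det Ar \<noteq> 0"
    using nonzero_blocks unfolding Ar(1)
    by (subst det_diag_block_mat)
      (auto simp: prod_list_zero_iff det_real_jordan_block_nonzero real_jordan_block_square simp del: square_mat.simps)
  have n: "n = r0 + sum_list rs"
    using A Ar(2) by (auto simp: dim_diag_block_mat comp_def)
  have "map dim_row Bs = rs"
    using Bs by (intro nth_equalityI) auto
  then have Bc: "B \<in> carrier_mat n m"
    using stack_rows_carrier[of "Br # Bs" m] Br Bs unfolding B n by (auto simp: in_set_conv_nth)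
  define L where "L = stack_rows b
    (the (mat_inverse Ar) * Br * U_B # map (\<lambda>Bi. X_tilde_block Bi U_B) Bs)"
  have last: "B_last m Bs *\<^sub>v col U_B j = 0\<^sub>v (length Bs)" if "j < b" for j
  proof -
    have "U_B *\<^sub>v unit_vec b j = col U_B j"
      using UB that by (intro eq_vecI) auto
    then have "col U_B j \<in> mat_kernel (B_last m Bs)"
      unfolding kerB mem_Collect_eq using unit_vec_carrier[of b j] by metis
    then show ?thesis using mat_kernelD[OF Bl] by blast
  qed
  have L: "L \<in> carrier_mat n b" and AL: "A * L = B * U_B"
    using X_tilde_left_block[OF Ar(2) det_Ar zero_blocks Br Bs UB last] A(1) B n
    by (auto simp: L_def)
  have ALv: "A *\<^sub>v (L *\<^sub>v v) = B *\<^sub>v (U_B *\<^sub>v v)" if v: "v \<in> carrier_vec b" for v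
    using assoc_mult_mat_vec[OF A(2) L v] assoc_mult_mat_vec[OF Bc UB v] AL by simp
  have X: "X_tilde Ar Br Bs U_B U_A = append_cols_mat L U_A"
    by (simp add: X_tilde_def L_def b_def)
  have Xc: "X_tilde Ar Br Bs U_B U_A \<in> carrier_mat n (b + a)"
    unfolding X by (rule append_cols_mat_carrier[OF L UA])

  have Abar_c: "Abar \<in> carrier_mat (n + k) (n + k)"
    using A(2) Bc exo unfolding Abar by auto
  have Bbar_c: "Bbar \<in> carrier_mat (n + k) p"
    unfolding Bbar by (rule carrier_append_rows) (use Bc exo in auto)
  have Cbar_c: "Cbar \<in> carrier_mat q (n + k)"
    unfolding Cbar by (rule append_cols_mat_carrier) (use C in auto)
  have P_are: "psd_are_solution Abar Bbar (transpose_mat Cbar * Cbar) P"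
    using P by (simp add: smallest_psd_are_solution_def)
  then have Pc: "P \<in> carrier_mat (n + k) (n + k)"
    using Abar_c by (auto simp: psd_are_solution_def psd_def)
  have Mc: "Abar - Bbar * transpose_mat Bbar * P \<in> carrier_mat (n + k) (n + k)"
    using Abar_c Bbar_c Pc by auto
  have ss: "xbar_ss \<in> carrier_vec (n + k)"
    using steady carrier_matD(1)[OF Mc] by (simp only: steady_state_def)
  have "Abar *\<^sub>v xbar_ss = 0\<^sub>v (n + k)"
    by (rule closed_loop_kernel_subset_open_loop_kernel
        [OF Abar_c Bbar_c Cbar_c P_are ss steady_state_in_kernel[OF Mc steady]])
  \<comment> \<open>\<open>u\<close> is the constant input that holds the agents at their steady state \<open>x\<close>.\<close>
  define x u where "x = vec_first xbar_ss n" and "u = H *\<^sub>v vec_last xbar_ss k"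
  have x: "x \<in> carrier_vec n" and u: "u \<in> carrier_vec m"
    using exo by (auto simp: x_def u_def)
  have "A *\<^sub>v x + (B * H) *\<^sub>v vec_last xbar_ss k = 0\<^sub>v n"
    unfolding x_def
    by (rule four_block_kernel_upper[of _ _ _ _ F1 F2])
      (use A(2) Bc exo ss \<open>Abar *\<^sub>v xbar_ss = 0\<^sub>v (n + k)\<close> Abar in auto)
  then have eq: "A *\<^sub>v x + B *\<^sub>v u = 0\<^sub>v n"
    using Bc exo(4) by (simp add: u_def)

  have "B_last m Bs *\<^sub>v u = 0\<^sub>v (length Bs)"
    by (rule B_last_mult_eq_0[OF Ar(2) zero_blocks Br Bs])
      (use eq A(1) B n x u in auto)
  then obtain y where y: "y \<in> carrier_vec b" and u_eq: "u = U_B *\<^sub>v y"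
    using mat_kernelI[OF Bl u] kerB by auto
  \<comment> \<open>Since \<open>A L = B U_B\<close>, the vector \<open>L y\<close> cancels the input, and only a kernel vector of \<open>A\<close> is left.\<close>
  have Ly: "L *\<^sub>v y \<in> carrier_vec n"
    using L y by (rule mult_mat_vec_carrier)
  have "A *\<^sub>v (x + L *\<^sub>v y) = A *\<^sub>v x + A *\<^sub>v (L *\<^sub>v y)"
    by (rule mult_add_distrib_mat_vec[OF A(2) x Ly])
  then have "A *\<^sub>v (x + L *\<^sub>v y) = 0\<^sub>v n"
    using eq ALv[OF y] u_eq by simp
  then obtain z where z: "z \<in> carrier_vec a" and sum: "x + L *\<^sub>v y = U_A *\<^sub>v z"
    using mat_kernelI[OF A(2) _ \<open>A *\<^sub>v (x + L *\<^sub>v y) = 0\<^sub>v n\<close>] x Ly kerA by auto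
  have "x = X_tilde Ar Br Bs U_B U_A *\<^sub>v (- y @\<^sub>v z)"
    unfolding X append_cols_mat_mult_vec[OF L UA uminus_carrier_vec[THEN iffD2, OF y] z]
  proof (rule eq_vecI)
    fix i assume "i < dim_vec (L *\<^sub>v (- y) + U_A *\<^sub>v z)"
    then show "x $ i = (L *\<^sub>v (- y) + U_A *\<^sub>v z) $ i"
      using arg_cong[OF sum, of "\<lambda>v. v $ i"] L UA x y z by (simp add: row_carrier)
  qed (use x UA in auto)
  moreover have "- y @\<^sub>v z \<in> carrier_vec (b + a)"
    using y z by auto
  ultimately have "x \<in> vec_space.col_space n (X_tilde Ar Br Bs U_B U_A)"
    unfolding col_space_eq_range[OF Xc] by blast
  moreover have "lin_indpt_cols (X_tilde Ar Br Bs U_B U_A)" if "lin_indpt_cols B"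
    unfolding lin_indpt_cols_iff_injective[OF Xc]
  proof (intro ballI impI)
    fix v assume v: "v \<in> carrier_vec (b + a)" and Xv: "X_tilde Ar Br Bs U_B U_A *\<^sub>v v = 0\<^sub>v n"
    define y z where "y = vec_first v b" and "z = vec_last v a"
    have y: "y \<in> carrier_vec b" and z: "z \<in> carrier_vec a" and v_eq: "v = y @\<^sub>v z"
      using v by (simp_all add: y_def z_def)
    have sum0: "L *\<^sub>v y + U_A *\<^sub>v z = 0\<^sub>v n"
      using Xv append_cols_mat_mult_vec[OF L UA y z] by (simp add: X v_eq)
    have "A *\<^sub>v (U_A *\<^sub>v z) = 0\<^sub>v n"
      using kerA z mat_kernelD(2)[OF A(2)] by blast
    moreover have "A *\<^sub>v 0\<^sub>v n = 0\<^sub>v n"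
      using A(2) by (intro eq_vecI) auto
    moreover have "A *\<^sub>v (L *\<^sub>v y + U_A *\<^sub>v z) = A *\<^sub>v (L *\<^sub>v y) + A *\<^sub>v (U_A *\<^sub>v z)"
      by (rule mult_add_distrib_mat_vec) (use A(2) L UA y z in auto)
    ultimately have "B *\<^sub>v (U_B *\<^sub>v y) = 0\<^sub>v n"
      using sum0 ALv[OF y] \<open>A *\<^sub>v 0\<^sub>v n = 0\<^sub>v n\<close> Bc UB y by auto
    then have "U_B *\<^sub>v y = 0\<^sub>v m"
      using that UB y unfolding lin_indpt_cols_iff_injective[OF Bc] by auto
    then have y0: "y = 0\<^sub>v b"
      using orthonormal_cols_injective[OF UB U_B(2) y] by simp
    have L0: "L *\<^sub>v 0\<^sub>v b = 0\<^sub>v n"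
      using L by (intro eq_vecI) auto
    have "U_A *\<^sub>v z = 0\<^sub>v n"
      using sum0 L0 UA z y0 by auto
    then have "z = 0\<^sub>v a"
      using orthonormal_cols_injective[OF UA U_A(2) z] by simp
    then show "v = 0\<^sub>v (b + a)"
      using y0 v_eq by auto
  qed
  ultimately show ?thesis
    unfolding x_def by blast
qed

end
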